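(* Let $R$ be an integral domain containing $\mathbb{Z}$ and let $a_0+a_1x+a_2x^2+\cdots\in R[[x]]$. Let $m\in\mathbb{Z}$, and if $m<0$ assume that $a_0$ is invertible in $R$. Then $(a_0+a_1x+a_2x^2+\cdots)^m$ is in $R[[x]]$ and $$(a_0+a_1x+a_2x^2+\cdots)^m=\sum_{n=0}^\infty\left[\sum_{k=0}^n\binom{m}{k}a_0^{m-k}\mathcal{A}_{n,k}(a_1,a_2,\dots)\right]x^n .$$ In particular, if $a_0$ is invertible in $R$, the multiplicative inverse of the series is given by $$(a_0+a_1x+a_2x^2+\cdots)^{-1}=\sum_{n=0}^\infty\left[\sum_{k=0}^n(-1)^ka_0^{-k-1}\mathcal{A}_{n,k}(a_1,a_2,\dots)\right]x^n .$$
   Context: $R[[x]]$ is the ring of formal power series over $R$ (commutative). For integers $n,k$ with $k\geq 0$, the De Moivre polynomial $\mathcal{A}_{n,k}(a_1,a_2,a_3,\dots)$ is the coefficient of $x^n$ in the $k$th power of the formal series without constant term with coefficients $a_j$: $$(a_1x+a_2x^2+a_3x^3+\cdots)^k=\sum_{n\in\mathbb{Z}}\mathcal{A}_{n,k}(a_1,a_2,a_3,\dots)\,x^n .$$ It is $0$ if $n<k$; if $n\geq k$ it is a polynomial with integer coefficients in $a_1,\dots,a_{n-k+1}$. General binomial coefficients are $\binom{m}{0}=1$ and $\binom{m}{k}=m(m-1)\cdots(m-k+1)/k!$ for $k\geq1$ (an integer when $m\in\mathbb{Z}$). Convention: $0^0=1$, and when $0\leq m<k$, so that $\binom{m}{k}=0$,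 the term with factor $\binom{m}{k}a_0^{m-k}$ is understood to be $0$ even if $a_0$ is not invertible. *)

theory Defs
  imports "HOL-Computational_Algebra.Formal_Power_Series"
begin

text \<open>
  Inverses and integer powers of units in a commutative ring. The library operations
  \<^const>\<open>inverse\<close> and \<^const>\<open>power_int\<close> require a type class with division, which neither
  a general integral domain nor the power series ring over it belongs to. The value of
  \<open>unit_inverse x\<close> is meaningful only if \<open>x\<close> is a unit (\<open>x dvd 1\<close>).
\<close>

definition unit_inverse :: "'a::comm_ring_1 \<Rightarrow> 'a"
  where "unit_inverse x = (THE y. x * y = 1)"

definition unit_powi :: "'a::comm_ring_1 \<Rightarrow> int \<Rightarrow> 'a"
  where "unit_powi x m = (if m \<ge> 0 then x ^ nat m else unit_inverse x ^ nat (- m))"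

lemma unit_inverse_eqI:
  fixes x y :: "'a::comm_ring_1"
  assumes "x * y = 1"
  shows "unit_inverse x = y"
  unfolding unit_inverse_def
proof (rule the_equality)
  fix z assume "x * z = 1"
  have "z = (x * y) * z" using assms by simp
  also have "\<dots> = y * (x * z)" by (simp add: ac_simps)
  finally show "z = y" using \<open>x * z = 1\<close> by simp
qed (fact assms)

lemma unit_inverse_right:
  fixes x :: "'a::comm_ring_1"
  assumes "x dvd 1"
  shows "x * unit_inverse x = 1"
  using assms by (metis dvdE unit_inverse_eqI)

text \<open>
  General binomial coefficients with integer upper argument; \<open>fact k\<close> divides the product,
  so \<open>div\<close> is exact. This is the library's \<open>gbinomial\<close> at type \<open>int\<close>, which cannot be written
  here because the constraint for parsing \<open>gbinomial\<close> is \<open>field_char_0\<close> in this theory context.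
\<close>

definition int_binomial :: "int \<Rightarrow> nat \<Rightarrow> int"
  where "int_binomial m k = (\<Prod>i=0..<k. m - int i) div fact k"

lemmas gbinomial_eq_int_binomial = gbinomial_prod_rev [where 'a = int, folded int_binomial_def]

lemma int_binomial_mult_fact: "fact k * int_binomial m k = (\<Prod>i=0..<k. m - int i)"
  using gbinomial_int_mult_fact [of k m] by (simp only: gbinomial_eq_int_binomial)

text \<open>
  The De Moivre polynomial \<open>A\<^sub>n\<^sub>,\<^sub>k\<close> evaluated at the ring elements \<open>a 1, a 2, \<dots>\<close>.
  The entry \<open>a 0\<close> is not an argument of the polynomial and is discarded. Coefficients
  at negative exponents vanish, so \<open>n\<close> ranges over the natural numbers.
\<close>

definition de_moivre :: "nat \<Rightarrow> nat \<Rightarrow> (nat \<Rightarrow> 'a::comm_ring_1) \<Rightarrow> 'a"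
  where "de_moivre n k a = fps_nth (Abs_fps (\<lambda>j. if j = 0 then 0 else a j) ^ k) n"

end

theory Submission
  imports Defs
begin

text \<open>
  Write the series as \<open>a\<^sub>0 + f\<close> with \<open>f = a\<^sub>1 x + a\<^sub>2 x\<^sup>2 + \<dots>\<close>. The inner sum of the
  statement is the \<open>n\<close>-th coefficient of the composition \<open>B\<^sub>m \<circ> f\<close>, where
  \<open>B\<^sub>m = \<Sum>\<^sub>k binom(m,k) a\<^sub>0\<^bsup>m-k\<^esup> x\<^sup>k\<close> is the binomial series of \<open>(a\<^sub>0 + x)\<^sup>m\<close>;
  truncating at \<open>k = n\<close> loses nothing, because \<open>f\<close> has no constant term. Substituting \<open>f\<close> for \<open>x\<close>
  is a ring homomorphism, so it is enough to treat the series \<open>a\<^sub>0 + x\<close>.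

  There, Pascal's rule says exactly that \<open>B\<^sub>m\<^sub>+\<^sub>1 = B\<^sub>m (a\<^sub>0 + x)\<close>
  (\<open>binomial_series_step\<close>), and composing with \<open>f\<close> gives the same recurrence for
  \<open>B\<^sub>m \<circ> f\<close> with factor \<open>a\<^sub>0 + f\<close>. Since \<open>B\<^sub>0 = 1\<close>, the recurrence determines all values:
  upwards from \<open>m = 0\<close> without any hypothesis on \<open>a\<^sub>0\<close>, and downwards by cancelling the factor
  when \<open>a\<^sub>0\<close> is a unit. In the second case, \<open>m = -1\<close> exhibits an inverse of \<open>a\<^sub>0 + f\<close>, which shows
  that it is a unit.
\<close>

lemma unit_powi_0 [simp]: "unit_powi x 0 = 1"
  by (simp add: unit_powi_def)

lemma unit_powi_add_one:
  fixes x :: "'a::comm_ring_1"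
  assumes "0 \<le> m \<or> x dvd 1"
  shows "unit_powi x (m + 1) = unit_powi x m * x"
proof (cases "0 \<le> m")
  case True
  then show ?thesis
    by (simp add: unit_powi_def nat_add_distrib)
next
  case False
  have inv: "unit_inverse x * x = 1"
    using assms False by (simp add: unit_inverse_right mult.commute)
  obtain j where m: "m = - int (Suc j)"
    using False by (metis int_cases of_nat_0_le_iff)
  have "unit_powi x m * x = unit_inverse x ^ j * (unit_inverse x * x)"
    by (simp add: unit_powi_def m nat_add_distrib ac_simps)
  moreover have "unit_powi x (m + 1) = unit_inverse x ^ j"
    by (cases j) (simp_all add: unit_powi_def m nat_add_distrib)
  ultimately show ?thesis
    by (simp add: inv)
qed

lemma unit_powi_minus_one: "unit_powi x (- 1) = unit_inverse x"
  by (simp add: unit_powi_def)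

lemma int_binomial_0_right [simp]: "int_binomial m 0 = 1"
  by (simp add: int_binomial_def)

lemma int_binomial_eq_0:
  assumes "0 \<le> m" "m < int k"
  shows "int_binomial m k = 0"
proof -
  have "(\<Prod>i=0..<k. m - int i) = 0"
    using assms by (intro prod_zero bexI[of _ "nat m"]) auto
  then show ?thesis
    unfolding int_binomial_def by (simp only: div_0)
qed

lemma of_int_int_binomial: "(of_int (int_binomial m k) :: rat) = of_int m gchoose k"
proof -
  have "(of_int (fact k * int_binomial m k) :: rat) = (\<Prod>i=0..<k. of_int m - of_nat i)"
    by (simp add: int_binomial_mult_fact)
  then show ?thesis
    by (simp add: gbinomial_prod_rev field_simps)
qed

lemma int_binomial_pascal:
  "int_binomial (m + 1) (Suc k) = int_binomial m k + int_binomial m (Suc k)"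
proof -
  have "(of_int (int_binomial (m + 1) (Suc k)) :: rat)
      = of_int (int_binomial m k + int_binomial m (Suc k))"
    by (simp add: of_int_int_binomial gbinomial_Suc_Suc)
  then show ?thesis
    by (simp only: of_int_eq_iff)
qed

lemma int_binomial_minus_one: "int_binomial (- 1) k = (- 1) ^ k"
proof (induction k)
  case (Suc k)
  have "int_binomial (- 1) k + int_binomial (- 1) (Suc k) = 0"
    using int_binomial_pascal[of "- 1" k] by (simp add: int_binomial_eq_0)
  with Suc show ?case by simp
qed simp

unbundle fps_syntax

definition binomial_series :: "'a::comm_ring_1 \<Rightarrow> int \<Rightarrow> 'a fps"
  where "binomial_series c m = Abs_fps (\<lambda>k. of_int (int_binomial m k) * unit_powi c (m - int k))"

lemma binomial_series_0 [simp]: "binomial_series c 0 = 1"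
  by (rule fps_ext) (simp add: binomial_series_def int_binomial_eq_0)

text \<open>
  If \<open>c\<close> is not a unit, the exponent law for \<open>c\<close> fails at negative exponents; these occur only
  for \<open>k > m \<ge> 0\<close>, where the binomial coefficient vanishes.
\<close>
lemma binomial_coeff_mult_base:
  fixes c :: "'a::comm_ring_1"
  assumes "0 \<le> m \<or> c dvd 1"
  shows "of_int (int_binomial m k) * unit_powi c (m - int k) * c
       = of_int (int_binomial m k) * unit_powi c (m + 1 - int k)"
proof (cases "0 \<le> m \<and> m < int k")
  case False
  then have "unit_powi c (m - int k + 1) = unit_powi c (m - int k) * c"
    using assms by (intro unit_powi_add_one) auto
  then show ?thesis
    by (simp add: algebra_simps)
qed (simp add: int_binomial_eq_0)

lemma binomial_series_step:
  fixes c :: "'a::comm_ring_1"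
  assumes "0 \<le> m \<or> c dvd 1"
  shows "binomial_series c (m + 1) = binomial_series c m * (fps_const c + fps_X)"
proof (rule fps_ext)
  fix k
  show "binomial_series c (m + 1) $ k = (binomial_series c m * (fps_const c + fps_X)) $ k"
  proof (cases k)
    case 0
    then show ?thesis
      using unit_powi_add_one[OF assms] by (simp add: binomial_series_def distrib_left)
  next
    case (Suc j)
    have "(binomial_series c m * (fps_const c + fps_X)) $ k
        = of_int (int_binomial m k) * unit_powi c (m - int k) * c
          + of_int (int_binomial m j) * unit_powi c (m - int j)"
      by (simp add: binomial_series_def distrib_left Suc)
    also have "\<dots> = of_int (int_binomial m k + int_binomial m j) * unit_powi c (m - int j)"
      unfolding binomial_coeff_mult_base[OF assms] by (simp add: Suc algebra_simps)
    also have "int_binomial m k + int_binomial m j = int_binomial (m + 1) k"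
      by (simp add: Suc int_binomial_pascal)
    also have "m - int j = m + 1 - int k"
      by (simp add: Suc)
    also have "of_int (int_binomial (m + 1) k) * unit_powi c (m + 1 - int k)
        = binomial_series c (m + 1) $ k"
      by (simp add: binomial_series_def)
    finally show ?thesis by simp
  qed
qed

lemma binomial_series_compose_step:
  fixes f :: "'a::idom fps"
  assumes "f $ 0 = 0" "0 \<le> m \<or> c dvd 1"
  shows "binomial_series c (m + 1) oo f = (binomial_series c m oo f) * (fps_const c + f)"
  using assms
  by (simp add: binomial_series_step fps_compose_mult_distrib fps_compose_add_distrib)

lemma unit_const_plus_fps_dvd_1:
  fixes f :: "'a::idom fps"
  assumes "f $ 0 = 0" "c dvd 1"
  shows "fps_const c + f dvd 1"
proof -
  have "(binomial_series c (- 1) oo f) * (fps_const c + f) = binomial_series c (- 1 + 1) oo f"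
    using assms by (intro binomial_series_compose_step[symmetric]) auto
  also have "\<dots> = 1"
    by simp
  finally show ?thesis
    by (metis dvd_triv_right)
qed

theorem unit_powi_const_plus_fps:
  fixes f :: "'a::idom fps"
  assumes f: "f $ 0 = 0" and m: "0 \<le> m \<or> c dvd 1"
  shows "unit_powi (fps_const c + f) m = binomial_series c m oo f"
  using m
proof (induction m rule: int_induct[where k = 0])
  case base
  show ?case by simp
next
  case (step1 m)
  then show ?case
    by (simp add: unit_powi_add_one binomial_series_compose_step[OF f])
next
  case (step2 m)
  let ?F = "fps_const c + f"
  have c: "c dvd 1"
    using step2 by auto
  have F: "?F dvd 1"
    using f c by (rule unit_const_plus_fps_dvd_1)
  have "unit_powi ?F (m - 1) * ?F = unit_powi ?F m"
    using unit_powi_add_one[of "m - 1" ?F] F by simp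
  also have "\<dots> = binomial_series c m oo f"
    using step2 c by simp
  also have "\<dots> = (binomial_series c (m - 1) oo f) * ?F"
    using binomial_series_compose_step[OF f, of "m - 1" c] c by simp
  finally show ?case
    using F by auto
qed

text \<open>Composition of power series is defined with the inner sum truncated at \<open>k = n\<close>.\<close>
lemma binomial_series_compose_de_moivre:
  "binomial_series c m oo Abs_fps (\<lambda>j. if j = 0 then 0 else a j)
     = Abs_fps (\<lambda>n. \<Sum>k=0..n. of_int (int_binomial m k) * unit_powi c (m - int k) * de_moivre n k a)"
  by (simp add: fps_compose_def binomial_series_def de_moivre_def)

theorem proposition3p2:
  fixes a :: "nat \<Rightarrow> 'a::{idom, ring_char_0}"
  shows "(\<forall>m::int. (m < 0 \<longrightarrow> a 0 dvd 1) \<longrightarrow>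
            (m < 0 \<longrightarrow> Abs_fps a dvd 1) \<and>
            unit_powi (Abs_fps a) m =
              Abs_fps (\<lambda>n. \<Sum>k=0..n. of_int (int_binomial m k) * unit_powi (a 0) (m - int k) * de_moivre n k a))
       \<and> (a 0 dvd 1 \<longrightarrow>
            Abs_fps a dvd 1 \<and>
            unit_inverse (Abs_fps a) =
              Abs_fps (\<lambda>n. \<Sum>k=0..n. (-1) ^ k * unit_powi (a 0) (- int k - 1) * de_moivre n k a))"
proof -
  define f where "f = Abs_fps (\<lambda>j. if j = 0 then 0 else a j)"
  have f0: "f $ 0 = 0"
    by (simp add: f_def)
  have split: "Abs_fps a = fps_const (a 0) + f"
    by (rule fps_ext) (simp add: f_def)
  have unit: "Abs_fps a dvd 1" if "a 0 dvd 1"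
    unfolding split using f0 that by (rule unit_const_plus_fps_dvd_1)
  have expansion: "unit_powi (Abs_fps a) m =
      Abs_fps (\<lambda>n. \<Sum>k=0..n. of_int (int_binomial m k) * unit_powi (a 0) (m - int k) * de_moivre n k a)"
    if "m < 0 \<longrightarrow> a 0 dvd 1" for m
  proof -
    have "unit_powi (Abs_fps a) m = binomial_series (a 0) m oo f"
      unfolding split using f0 that by (intro unit_powi_const_plus_fps) auto
    then show ?thesis
      by (simp only: f_def binomial_series_compose_de_moivre)
  qed
  have "unit_inverse (Abs_fps a) =
      Abs_fps (\<lambda>n. \<Sum>k=0..n. (-1) ^ k * unit_powi (a 0) (- int k - 1) * de_moivre n k a)"
    if "a 0 dvd 1"
  proof -
    have exponent: "- 1 - int k = - int k - 1" for k
      by simp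
    show ?thesis
      using expansion[of "- 1"] that
      by (simp only: unit_powi_minus_one int_binomial_minus_one exponent
          of_int_power of_int_minus of_int_1 simp_thms)
  qed
  with unit expansion show ?thesis
    by blast
qed

end
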